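(* Let $\Phi=(G,\varphi)$ be a $\mathbb{T}$-gain graph on a connected graph $G$. Then $\mathcal{E}(\Phi)\geq 2\rho(\Phi)$. If $G$ is bipartite, then equality holds if and only if $\Phi\sim(K_{p,q},1)$ for some $p,q$.
   Context: A $\mathbb{T}$-gain graph $\Phi=(G,\varphi)$ consists of a finite simple graph $G$ and a map $\varphi$ assigning to each orientation $\overrightarrow{e_{p,q}}$ of each edge $v_pv_q$ a value in $\mathbb{T}=\{z\in\mathbb{C}:|z|=1\}$, with $\varphi(\overrightarrow{e_{q,p}})=\varphi(\overrightarrow{e_{p,q}})^{-1}$. Its adjacency matrix $A(\Phi)$ is the Hermitian matrix whose $(p,q)$ entry is $\varphi(\overrightarrow{e_{p,q}})$ if $v_p\sim v_q$ and $0$ otherwise; $\rho(\Phi)$ is its spectral radius and $\mathcal{E}(\Phi)$ the sum of absolute values of its eigenvalues. $\Phi\sim\Phi'$ (switching equivalence) means $A(\Phi')=UA(\Phi)U^*$ for some diagonal unitary matrix $U$; $(H,1)$ denotes the gain graph on $H$ with all gains equal to $1$. *)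

theory Defs
  imports
    "Graph_Theory.Graph_Theory"
    "Jordan_Normal_Form.Spectral_Radius"
    "Jordan_Normal_Form.Schur_Decomposition"
begin

text \<open>
  Finite simple graphs are the symmetric loopless digraphs \<^locale>\<open>pair_graph\<close>: an edge between
  \<open>p\<close> and \<open>q\<close> is represented by its two orientations \<open>(p, q)\<close> and \<open>(q, p)\<close>, which are the
  arcs on which a gain function lives. Values of a gain function outside the arcs are irrelevant.
  The vertices are numbered \<open>0, \<dots>, n - 1\<close>, so that they index the rows of the adjacency matrix.
\<close>

record gain_graph =
  base_graph :: "nat pair_pre_digraph"
  gain :: "nat \<times> nat \<Rightarrow> complex"

locale T_gain_graph = pair_graph "base_graph \<Phi>" for \<Phi> :: gain_graph +
  assumes verts_numbered: "pverts (base_graph \<Phi>) = {0..<card (pverts (base_graph \<Phi>))}"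
    and gain_unit: "(p, q) \<in> parcs (base_graph \<Phi>) \<Longrightarrow> cmod (gain \<Phi> (p, q)) = 1"
    and gain_reverse: "(p, q) \<in> parcs (base_graph \<Phi>) \<Longrightarrow> gain \<Phi> (q, p) = inverse (gain \<Phi> (p, q))"

definition num_verts :: "gain_graph \<Rightarrow> nat" where
  "num_verts \<Phi> = card (pverts (base_graph \<Phi>))"

definition adj_mat :: "gain_graph \<Rightarrow> complex mat" where
  "adj_mat \<Phi> = mat (num_verts \<Phi>) (num_verts \<Phi>)
     (\<lambda>(p, q). if (p, q) \<in> parcs (base_graph \<Phi>) then gain \<Phi> (p, q) else 0)"

definition rho :: "gain_graph \<Rightarrow> real" where
  "rho \<Phi> = spectral_radius (adj_mat \<Phi>)"

text \<open>The multiset of roots of the characteristic polynomial lists the eigenvalues with multiplicity.\<close>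

definition energy :: "gain_graph \<Rightarrow> real" where
  "energy \<Phi> = (\<Sum>x\<in>#proots (char_poly (adj_mat \<Phi>)). cmod x)"

definition unitary_mat :: "nat \<Rightarrow> complex mat \<Rightarrow> bool" where
  "unitary_mat n U \<longleftrightarrow> U \<in> carrier_mat n n \<and> U * mat_adjoint U = 1\<^sub>m n \<and> mat_adjoint U * U = 1\<^sub>m n"

definition switching_equivalent :: "gain_graph \<Rightarrow> gain_graph \<Rightarrow> bool" where
  "switching_equivalent \<Phi> \<Phi>' \<longleftrightarrow>
     (\<exists>U. unitary_mat (num_verts \<Phi>) U \<and> diagonal_mat U \<and>
          adj_mat \<Phi>' = U * adj_mat \<Phi> * mat_adjoint U)"

definition one_gain :: "nat pair_pre_digraph \<Rightarrow> gain_graph" where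
  "one_gain H = \<lparr>base_graph = H, gain = (\<lambda>_. 1)\<rparr>"

definition bipartite :: "'a pair_pre_digraph \<Rightarrow> bool" where
  "bipartite G \<longleftrightarrow>
     (\<exists>X Y. pverts G = X \<union> Y \<and> X \<inter> Y = {} \<and> parcs G \<subseteq> X \<times> Y \<union> Y \<times> X)"

text \<open>
  \<open>switching_equivalent_Kpq \<Phi> p q\<close> expresses that \<open>\<Phi>\<close> is switching equivalent to \<open>(K\<^sub>p\<^sub>,\<^sub>q, 1)\<close>.
  The graph \<open>K\<^sub>p\<^sub>,\<^sub>q\<close> is only determined up to the numbering of its vertices, hence the
  quantifier over the numbered graph \<open>H\<close>. A part may be empty: \<open>K\<^sub>1\<^sub>,\<^sub>0\<close> is the one-vertex graph, whose
  energy and spectral radius both vanish.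
\<close>

definition switching_equivalent_Kpq :: "gain_graph \<Rightarrow> nat \<Rightarrow> nat \<Rightarrow> bool" where
  "switching_equivalent_Kpq \<Phi> p q \<longleftrightarrow>
     (\<exists>H. complete_bipartite_digraph p q (with_proj H) \<and> T_gain_graph (one_gain H) \<and>
          switching_equivalent \<Phi> (one_gain H))"

end

theory Submission
  imports Defs
begin

text \<open>
  The matrix \<open>A = A(\<Phi>)\<close> has trace \<open>0\<close>, so an eigenvalue of maximal modulus is minus the sum of the
  others and the triangle inequality gives the bound. If \<open>G\<close> is bipartite, the spectrum is symmetric;
  hence equality forces the nonzero eigenvalues to be just \<open>\<plusminus>l\<close>, so that
  \<open>2 tr A\<^sup>4 = (tr A\<^sup>2)\<^sup>2\<close>. Entrywise, \<open>\<bar>(A\<^sup>2)\<^sub>i\<^sub>j\<bar>\<^sup>2 \<le> d\<^sub>i d\<^sub>j\<close> if \<open>i\<close> and \<open>j\<close> lie in the same part, and \<open>(A\<^sup>2)\<^sub>i\<^sub>j = 0\<close>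
  otherwise; as each part has degree sum \<open>m\<close> and \<open>tr A\<^sup>2 = 2 m\<close>, these bounds add up to
  \<open>2 m\<^sup>2 = tr A\<^sup>4\<close> and are all attained. So vertices of the same part have the same neighbours and
  proportional rows, which makes \<open>G\<close> complete bipartite and yields the switching. Conversely, every
  eigenvalue of \<open>K\<^sub>p\<^sub>,\<^sub>q\<close> satisfies \<open>l = 0\<close> or \<open>l\<^sup>2 = p q\<close>, and \<open>tr A\<^sup>2 = 2 p q\<close>.
\<close>

section \<open>Traces, similarity and powers of triangular matrices\<close>

definition trace :: "'a :: comm_monoid_add mat \<Rightarrow> 'a" where
  "trace A = (\<Sum>i<dim_row A. A $$ (i, i))"

lemma trace_mult:
  fixes A B :: "'a :: semiring_0 mat"
  assumes "A \<in> carrier_mat n m" "B \<in> carrier_mat m n"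
  shows "trace (A * B) = (\<Sum>i<n. \<Sum>k<m. A $$ (i, k) * B $$ (k, i))"
  using assms by (simp add: trace_def scalar_prod_def atLeast0LessThan)

lemma trace_mult_comm:
  fixes A B :: "'a :: comm_semiring_0 mat"
  assumes "A \<in> carrier_mat n m" "B \<in> carrier_mat m n"
  shows "trace (A * B) = trace (B * A)"
  unfolding trace_mult[OF assms] trace_mult[OF assms(2,1)]
  by (subst sum.swap) (simp add: mult.commute)

lemma trace_similar:
  fixes A B :: "'a :: comm_semiring_1 mat"
  assumes "similar_mat_wit A B P Q"
  shows "trace A = trace B"
proof -
  define n where "n = dim_row A"
  note wit = similar_mat_witD[OF n_def assms]
  note carrier = wit(5-7)
  have "trace A = trace (P * (B * Q))"
    unfolding wit(3) using carrier by (simp add: assoc_mult_mat[of P n n B n Q n])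
  also have "\<dots> = trace (B * Q * P)"
    using carrier by (intro trace_mult_comm) auto
  also have "B * Q * P = B"
    using carrier wit(2) by (simp add: assoc_mult_mat[of B n n Q n P n])
  finally show ?thesis .
qed

lemma upper_triangular_mult:
  fixes A B :: "'a :: semiring_0 mat"
  assumes A: "A \<in> carrier_mat n n" "upper_triangular A"
    and B: "B \<in> carrier_mat n n" "upper_triangular B"
  shows "upper_triangular (A * B)"
    and "i < n \<Longrightarrow> (A * B) $$ (i, i) = A $$ (i, i) * B $$ (i, i)"
proof -
  have entry: "(A * B) $$ (i, j) = (\<Sum>k<n. A $$ (i, k) * B $$ (k, j))" if "i < n" "j < n" for i j
    using A B that by (simp add: scalar_prod_def atLeast0LessThan)
  have zero: "A $$ (i, k) * B $$ (k, j) = 0" if "i < n" "k < n" "k < i \<or> j < k" for i j k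
    using A B that by (metis carrier_matD(1) mult_zero_left mult_zero_right upper_triangularD)
  show "upper_triangular (A * B)"
  proof
    fix i j assume ij: "j < i" "i < dim_row (A * B)"
    then have "i < n" "j < n" using A by auto
    then show "(A * B) $$ (i, j) = 0"
      using ij by (subst entry) (auto intro!: sum.neutral zero)
  qed
  show "(A * B) $$ (i, i) = A $$ (i, i) * B $$ (i, i)" if "i < n"
  proof -
    have "(\<Sum>k<n. A $$ (i, k) * B $$ (k, i)) = (\<Sum>k\<in>{i}. A $$ (i, k) * B $$ (k, i))"
      by (rule sum.mono_neutral_right) (use that zero[of i] in \<open>auto simp: nat_neq_iff\<close>)
    then show ?thesis using that by (simp add: entry)
  qed
qed

lemma upper_triangular_pow:
  fixes A :: "'a :: semiring_1 mat"
  assumes "A \<in> carrier_mat n n" "upper_triangular A"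
  shows "upper_triangular (A ^\<^sub>m k) \<and> (\<forall>i<n. (A ^\<^sub>m k) $$ (i, i) = (A $$ (i, i)) ^ k)"
proof (induction k)
  case (Suc k)
  have "A ^\<^sub>m k \<in> carrier_mat n n" using assms by simp
  from upper_triangular_mult[OF this _ assms] Suc show ?case
    by (simp add: power_commutes del: index_mult_mat)
qed (use assms in simp)

section \<open>Traces of powers as power sums of the eigenvalues\<close>

lemma proots_linear_factors:
  "proots (\<Prod>a\<leftarrow>as. [:- a, 1:]) = mset (as :: 'a :: idom list)"
proof (induction as)
  case (Cons a as)
  have "(\<Prod>a\<leftarrow>as. [:- a, 1:]) \<noteq> 0"
    by (auto simp: prod_list_zero_iff)
  with Cons show ?case
    by (simp add: proots_mult del: mult_pCons_left)
qed simp

text \<open>Schur triangularisation makes \<open>A ^\<^sub>m k\<close> similar to the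
  \<open>k\<close>-th power of an upper triangular matrix, whose diagonal carries the
  \<open>k\<close>-th powers of the eigenvalues with multiplicity.\<close>

lemma trace_pow_eq_sum_proots:
  fixes A :: "complex mat"
  assumes A: "A \<in> carrier_mat n n"
  shows "trace (A ^\<^sub>m k) = (\<Sum>x\<in>#proots (char_poly A). x ^ k)"
proof -
  obtain as where as: "char_poly A = (\<Prod>a\<leftarrow>as. [:- a, 1:])"
    using char_poly_factorized[OF A] by blast
  obtain B P Q where "schur_decomposition A as = (B, P, Q)"
    by (cases "schur_decomposition A as") auto
  from schur_decomposition[OF A as this]
  have wit: "similar_mat_wit A B P Q" and tri: "upper_triangular B" and diag: "diag_mat B = as"
    by auto
  have B: "B \<in> carrier_mat n n"
    using similar_mat_witD2[OF A wit] by auto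
  have "trace (A ^\<^sub>m k) = trace (B ^\<^sub>m k)"
    by (rule trace_similar[OF similar_mat_wit_pow[OF wit]])
  also have "\<dots> = (\<Sum>i<n. B $$ (i, i) ^ k)"
    using upper_triangular_pow[OF B tri] B by (simp add: trace_def pow_mat_dim_square)
  also have "\<dots> = (\<Sum>x\<leftarrow>as. x ^ k)"
    using B unfolding diag[symmetric] diag_mat_def
    by (simp add: interv_sum_list_conv_sum_set_nat o_def atLeast0LessThan)
  also have "\<dots> = (\<Sum>x\<in>#proots (char_poly A). x ^ k)"
    unfolding as proots_linear_factors by (simp flip: sum_mset_sum_list mset_map)
  finally show ?thesis .
qed

lemma set_proots_char_poly:
  fixes A :: "'a :: field mat"
  assumes A: "A \<in> carrier_mat n n"
  shows "set_mset (proots (char_poly A)) = spectrum A"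
proof -
  have "char_poly A \<noteq> 0"
    using degree_monic_char_poly[OF A] by auto
  then show ?thesis
    using spectrum_root_char_poly[OF A] by simp
qed

section \<open>Spectral radius versus the sum of the moduli of the eigenvalues\<close>

lemma cmod_sum_mset_le: "cmod (\<Sum>x\<in>#M. f x) \<le> (\<Sum>x\<in>#M. cmod (f x))"
  by (induction M) (auto intro: norm_triangle_mono)

lemma two_spectral_radius_le:
  fixes A :: "complex mat"
  assumes A: "A \<in> carrier_mat n n" and "n > 0" and "trace A = 0"
  shows "2 * spectral_radius A \<le> (\<Sum>x\<in>#proots (char_poly A). cmod x)"
proof -
  let ?M = "proots (char_poly A)"
  obtain l where l: "l \<in># ?M" "spectral_radius A = cmod l"
    using spectral_radius_mem_max(1)[OF A \<open>n > 0\<close>] set_proots_char_poly[OF A] by auto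
  \<comment> \<open>Only one copy of \<open>l\<close> is split off; any further copies stay in
    \<open>R\<close>.\<close>
  then obtain R where R: "?M = add_mset l R"
    by (metis mset_add)
  have "(\<Sum>x\<in>#?M. x) = 0"
    using trace_pow_eq_sum_proots[OF A, of 1] A assms by simp
  then have "l = - (\<Sum>x\<in>#R. x)"
    unfolding R by (simp add: eq_neg_iff_add_eq_0)
  then have "cmod l \<le> (\<Sum>x\<in>#R. cmod x)"
    using cmod_sum_mset_le[of id R] by simp
  then show ?thesis
    unfolding R l(2) by simp
qed


text \<open>If \<open>l\<close> attains the spectral radius and is nonzero, then \<open>l\<close>
  and \<open>- l\<close> already account for the whole sum \<open>2 * spectral_radius A\<close>. All
  remaining eigenvalues vanish, so the traces are \<open>2 * l\<^sup>2\<close> and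
  \<open>2 * l ^ 4\<close>.\<close>

lemma two_spectral_radius_eq_imp_trace:
  fixes A :: "complex mat"
  assumes A: "A \<in> carrier_mat n n" and "n > 0"
    and sym: "\<And>l. l \<in> spectrum A \<Longrightarrow> - l \<in> spectrum A"
    and eq: "(\<Sum>x\<in>#proots (char_poly A). cmod x) = 2 * spectral_radius A"
  shows "2 * trace (A ^\<^sub>m 4) = (trace (A ^\<^sub>m 2))\<^sup>2"
proof -
  let ?M = "proots (char_poly A)"
  note trace = trace_pow_eq_sum_proots[OF A]
  obtain l where l: "l \<in> spectrum A" "spectral_radius A = cmod l"
    using spectral_radius_mem_max(1)[OF A \<open>n > 0\<close>] by auto
  have zero: "\<forall>x\<in>#R. x = 0" if "(\<Sum>x\<in>#R. cmod x) = 0" for R :: "complex multiset"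
    using that
  proof (induction R)
    case (add y R)
    have "(\<Sum>x\<in>#R. cmod x) \<ge> 0"
      by (induction R) auto
    with add show ?case
      by (auto simp: add_nonneg_eq_0_iff)
  qed simp
  have sum_pow: "(\<Sum>x\<in>#R. x ^ k) = 0" if "(\<Sum>x\<in>#R. cmod x) = 0" "k > 0"
    for R :: "complex multiset" and k :: nat
    using zero[OF that(1)] that(2) by (simp add: sum_mset.neutral zero_power)
  show ?thesis
  \<comment> \<open>For \<open>l = 0\<close> the values \<open>l\<close> and \<open>- l\<close> need
    not be two members of the spectrum, but then every eigenvalue is 0 and both traces
    vanish.\<close>
  proof (cases "l = 0")
    case True
    with eq l have "(\<Sum>x\<in>#?M. cmod x) = 0" by simp
    from sum_pow[OF this] show ?thesis by (simp add: trace)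
  next
    case False
    obtain R where R: "?M = add_mset l (add_mset (- l) R)"
    proof -
      from l obtain R where "?M = add_mset l R"
        using set_proots_char_poly[OF A] by (metis mset_add)
      \<comment> \<open>Since \<open>- l\<close> differs from \<open>l\<close>, it survives the
        removal of one copy of \<open>l\<close>.\<close>
      moreover have "- l \<in># ?M" "- l \<noteq> l"
        using sym[OF l(1)] set_proots_char_poly[OF A] False by auto
      ultimately show ?thesis
        using that by (metis insert_noteq_member mset_add)
    qed
    then have "(\<Sum>x\<in>#R. cmod x) = 0"
      using eq l(2) by simp
    from sum_pow[OF this] have "trace (A ^\<^sub>m 2) = 2 * l\<^sup>2" "trace (A ^\<^sub>m 4) = 2 * l ^ 4"
      by (simp_all add: trace R)
    then show ?thesis
      by (simp add: power_mult_distrib flip: power_mult)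
  qed
qed

text \<open>Every nonzero eigenvalue has modulus \<open>s = sqrt c\<close>, so
  \<open>s * cmod x = x\<^sup>2\<close> for each eigenvalue \<open>x\<close>. Summation turns the
  sum of moduli, scaled by \<open>s\<close>, into the known trace \<open>2 * s\<^sup>2\<close>;
  dividing by \<open>s\<close> gives \<open>2 * s\<close>. For the complete bipartite graph
  \<open>c\<close> is \<open>p * q\<close>.\<close>

lemma two_spectral_radius_eqI:
  fixes A :: "complex mat"
  assumes A: "A \<in> carrier_mat n n" and "n > 0"
    and ev: "\<And>l. l \<in> spectrum A \<Longrightarrow> l = 0 \<or> l\<^sup>2 = of_real c"
    and tr: "trace (A ^\<^sub>m 2) = of_real (2 * c)" and "c \<ge> 0"
  shows "(\<Sum>x\<in>#proots (char_poly A). cmod x) = 2 * spectral_radius A"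
proof -
  let ?M = "proots (char_poly A)"
  note spec = set_proots_char_poly[OF A]
  define s where "s = sqrt c"
  have c: "c = s\<^sup>2" "s \<ge> 0"
    using \<open>c \<ge> 0\<close> by (auto simp: s_def)
  have cmod: "cmod l = s" if "l \<in> spectrum A" "l \<noteq> 0" for l
  proof -
    have "(cmod l)\<^sup>2 = s\<^sup>2"
      using ev[OF that(1)] that(2) c by (metis norm_of_real norm_power abs_of_nonneg \<open>c \<ge> 0\<close>)
    then show ?thesis using c by simp
  qed
  have sum2: "(\<Sum>x\<in>#?M. x\<^sup>2) = of_real (2 * c)"
    using trace_pow_eq_sum_proots[OF A, of 2] tr by simp
  have "of_real (s * (\<Sum>x\<in>#R. cmod x)) = (\<Sum>x\<in>#R. of_real (s * cmod x) :: complex)"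
    for R :: "complex multiset"
    by (induction R) (simp_all add: distrib_left)
  then have "of_real (s * (\<Sum>x\<in>#?M. cmod x)) = (\<Sum>x\<in>#?M. of_real (s * cmod x) :: complex)" .
  also have "\<dots> = (\<Sum>x\<in>#?M. x\<^sup>2)"
  proof (intro arg_cong[of _ _ sum_mset] image_mset_cong)
    fix x assume "x \<in># ?M"
    then show "of_real (s * cmod x) = x\<^sup>2"
      using ev[of x] cmod[of x] spec c by (cases "x = 0") (auto simp: power2_eq_square)
  qed
  finally have sum: "s * (\<Sum>x\<in>#?M. cmod x) = 2 * s\<^sup>2"
    unfolding sum2 c(1) using of_real_eq_iff by blast
  show ?thesis
  \<comment> \<open>Division by \<open>s\<close> requires \<open>s\<close> to be nonzero; otherwise
    all eigenvalues are 0 and both sides vanish.\<close>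
  proof (cases "s = 0")
    case True
    then have "cmod x = 0" if "x \<in> spectrum A" for x
      using cmod[OF that] by auto
    then have 0: "x = 0" if "x \<in> spectrum A" for x
      using that by simp
    then have "(\<Sum>x\<in>#?M. cmod x) = 0"
      by (intro sum_mset.neutral) (auto simp: spec)
    moreover have "spectral_radius A = 0"
      using spectral_radius_mem_max(1)[OF A \<open>n > 0\<close>] 0 by auto
    ultimately show ?thesis by simp
  next
    case False
    \<comment> \<open>A nonzero eigenvalue is what excludes spectral radius 0, leaving
      \<open>s\<close> as its only possible value.\<close>
    have "\<exists>x\<in>#?M. x \<noteq> 0"
    proof (rule ccontr)
      assume "\<not> ?thesis"
      then have "(\<Sum>x\<in>#?M. x\<^sup>2) = 0"
        by (intro sum_mset.neutral) auto
      with sum2 c False show False by simp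
    qed
    then obtain x where "x \<in> spectrum A" "cmod x = s"
      using spec cmod by auto
    then have "s \<le> spectral_radius A"
      using spectral_radius_mem_max(2)[OF A \<open>n > 0\<close>] by auto
    moreover have "spectral_radius A \<in> {0, s}"
      using spectral_radius_mem_max(1)[OF A \<open>n > 0\<close>] cmod by (metis imageE insertCI norm_zero)
    ultimately have "spectral_radius A = s"
      using c False by auto
    moreover have "s * (\<Sum>x\<in>#?M. cmod x) = s * (2 * s)"
      unfolding sum by (simp add: power2_eq_square)
    ultimately show ?thesis
      using False by (metis mult_left_cancel)
  qed
qed

section \<open>Unit complex numbers, diagonal matrices and small powers\<close>

lemma unit_sum_eq_card_imp_eq:
  fixes z :: "'a \<Rightarrow> complex"
  assumes "finite S" and unit: "\<And>k. k \<in> S \<Longrightarrow> cmod (z k) = 1"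
    and eq: "cmod (\<Sum>k\<in>S. z k) = card S" and "k \<in> S" "l \<in> S"
  shows "z k = z l"
proof -
  define s where "s = (\<Sum>k\<in>S. z k)"
  have "cmod s > 0"
    using assms by (auto simp: s_def card_gt_0_iff)
  \<comment> \<open>The terms are projected onto the direction of their sum \<open>s\<close>. The
    projections are at most \<open>cmod s\<close> each and add up to \<open>card S * cmod s\<close>,
    so each of them attains its bound.\<close>
  have "(\<Sum>k\<in>S. Re (z k * cnj s)) = Re (s * cnj s)"
    by (simp add: s_def sum_distrib_right del: Re_complex_of_real)
  also have "s * cnj s = of_real (cmod s * cmod s)"
    by (simp add: complex_norm_square[symmetric] power2_eq_square)
  finally have "(\<Sum>k\<in>S. Re (z k * cnj s)) = (\<Sum>k\<in>S. cmod s)"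
    using eq by (simp add: s_def)
  moreover have "Re (z k * cnj s) \<le> cmod s" if "k \<in> S" for k
    using complex_Re_le_cmod[of "z k * cnj s"] unit[OF that] by (simp add: norm_mult)
  ultimately have Re: "Re (z k * cnj s) = cmod s" if "k \<in> S" for k
    using that \<open>finite S\<close> by (intro sum_mono_inv[where I = S and g = "\<lambda>_. cmod s"])
  have "z k * cnj s = cmod s" if "k \<in> S" for k
  proof -
    \<comment> \<open>A complex number whose modulus equals its real part is real. Hence
      \<open>z k * cnj s\<close> is the same for all \<open>k\<close>, and the nonzero factor
      \<open>cnj s\<close> cancels.\<close>
    have "cmod (z k * cnj s) = Re (z k * cnj s)"
      using Re[OF that] unit[OF that] by (simp add: norm_mult)
    then have "Im (z k * cnj s) = 0"
      using cmod_power2[of "z k * cnj s"] by simp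
    then show ?thesis
      using Re[OF that] by (intro complex_eqI) simp_all
  qed
  then have "z k * cnj s = z l * cnj s"
    using assms by simp
  with \<open>cmod s > 0\<close> show ?thesis by simp
qed

lemma inverse_unit: "cmod z = 1 \<Longrightarrow> inverse z = cnj z"
  by (rule inverse_unique) (simp add: complex_norm_square[symmetric])

lemma mat_adjoint_mat_diag: "mat_adjoint (mat_diag n f) = mat_diag n (\<lambda>i. cnj (f i))"
  by (rule eq_matI) (auto simp: mat_adjoint_def mat_diag_def mat_of_rows_def)

lemma pow_mat_2: "A \<in> carrier_mat n n \<Longrightarrow> A ^\<^sub>m 2 = A * (A :: 'a :: semiring_1 mat)"
  by (simp add: numeral_eq_Suc)

lemma pow_mat_4: "A \<in> carrier_mat n n \<Longrightarrow> A ^\<^sub>m 4 = A * A * (A * (A :: 'a :: semiring_1 mat))"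
proof -
  assume A: "A \<in> carrier_mat n n"
  then have "A ^\<^sub>m 4 = A * A * A * A" by (simp add: numeral_eq_Suc)
  also have "\<dots> = A * A * (A * A)"
    using A by (intro assoc_mult_mat[of _ n n _ n _ n]) auto
  finally show ?thesis .
qed

section \<open>Entries and traces of the powers of the adjacency matrix\<close>

context T_gain_graph
begin

abbreviation n :: nat where "n \<equiv> num_verts \<Phi>"
abbreviation A :: "complex mat" where "A \<equiv> adj_mat \<Phi>"
abbreviation E :: "(nat \<times> nat) set" where "E \<equiv> parcs (base_graph \<Phi>)"

definition nbh :: "nat \<Rightarrow> nat set" where
  "nbh i = {j. (i, j) \<in> E}"

lemma verts_eq: "pverts (base_graph \<Phi>) = {..<n}"
  using verts_numbered unfolding num_verts_def atLeast0LessThan .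

lemma arcD:
  assumes "(i, j) \<in> E"
  shows "i < n" "j < n" "(j, i) \<in> E" "i \<noteq> j"
proof -
  show "i < n" "j < n"
    using in_arcsD1[OF assms] in_arcsD2[OF assms] by (simp_all add: verts_eq)
  show "(j, i) \<in> E"
    using arcs_symmetric[OF assms] .
  show "i \<noteq> j"
    using no_loops'[OF assms] .
qed

lemma nbh_subset: "nbh i \<subseteq> {..<n}"
  by (auto simp: nbh_def dest: arcD)

lemma finite_nbh [simp]: "finite (nbh i)"
  by (rule finite_subset[OF nbh_subset]) simp

lemma nbh_sym: "j \<in> nbh i \<longleftrightarrow> i \<in> nbh j"
  by (auto simp: nbh_def dest: arcD)

lemma A_carrier: "A \<in> carrier_mat n n"
  by (simp add: adj_mat_def)

lemma A_dim [simp]: "dim_row A = n" "dim_col A = n"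
  by (simp_all add: adj_mat_def)

lemma A_entry: "i < n \<Longrightarrow> j < n \<Longrightarrow> A $$ (i, j) = (if j \<in> nbh i then gain \<Phi> (i, j) else 0)"
  by (simp add: adj_mat_def nbh_def)

lemma A_zero: "i < n \<Longrightarrow> j < n \<Longrightarrow> j \<notin> nbh i \<Longrightarrow> A $$ (i, j) = 0"
  by (simp add: A_entry)

lemma A_unit: "j \<in> nbh i \<Longrightarrow> cmod (A $$ (i, j)) = 1"
  using gain_unit[of i j] arcD[of i j] by (simp add: A_entry nbh_def)

lemma A_cnj: assumes "i < n" "j < n" shows "A $$ (j, i) = cnj (A $$ (i, j))"
  using assms gain_unit[of i j] gain_reverse[of i j] arcD(3)[of i j] arcD(3)[of j i]
  by (auto simp: adj_mat_def inverse_unit)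

lemma trace_A: "trace A = 0"
  by (auto simp: trace_def A_entry nbh_def dest: arcD intro!: sum.neutral)

text \<open>As \<open>A\<close> is Hermitian, an entry of \<open>A * A\<close> is the Hermitian
  inner product of two rows, and only common neighbours contribute.\<close>

lemma A_square_entry:
  assumes "i < n" "j < n"
  shows "(A * A) $$ (i, j) = (\<Sum>k\<in>nbh i \<inter> nbh j. A $$ (i, k) * cnj (A $$ (j, k)))"
proof -
  have "(A * A) $$ (i, j) = (\<Sum>k<n. A $$ (i, k) * cnj (A $$ (j, k)))"
    using assms by (auto simp: scalar_prod_def atLeast0LessThan A_cnj[of j] intro!: sum.cong)
  also have "\<dots> = (\<Sum>k\<in>nbh i \<inter> nbh j. A $$ (i, k) * cnj (A $$ (j, k)))"
  proof (rule sum.mono_neutral_right)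
    show "\<forall>k\<in>{..<n} - nbh i \<inter> nbh j. A $$ (i, k) * cnj (A $$ (j, k)) = 0"
      using assms A_zero[of i] A_zero[of j] by auto
  qed (use nbh_subset in auto)
  finally show ?thesis .
qed

lemma cmod_A_square_le:
  assumes "i < n" "j < n"
  shows "cmod ((A * A) $$ (i, j)) \<le> card (nbh i \<inter> nbh j)"
proof -
  have "cmod ((A * A) $$ (i, j)) \<le> (\<Sum>k\<in>nbh i \<inter> nbh j. cmod (A $$ (i, k) * cnj (A $$ (j, k))))"
    unfolding A_square_entry[OF assms] by (rule norm_sum)
  also have "\<dots> = card (nbh i \<inter> nbh j)"
    by (simp add: norm_mult A_unit)
  finally show ?thesis .
qed

lemma A_square_diag: assumes "i < n" shows "(A * A) $$ (i, i) = card (nbh i)"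
proof -
  have "(A * A) $$ (i, i) = (\<Sum>k\<in>nbh i. 1)"
    unfolding A_square_entry[OF assms assms]
    by (rule sum.cong) (auto simp: A_unit complex_norm_square[symmetric])
  then show ?thesis by simp
qed

lemma trace_A_2: "trace (A ^\<^sub>m 2) = of_nat (\<Sum>i<n. card (nbh i))"
  unfolding pow_mat_2[OF A_carrier]
  by (simp add: trace_def A_square_diag del: index_mult_mat(1))

text \<open>\<open>A * A\<close> is Hermitian too, so the trace of its square is its squared
  Frobenius norm.\<close>

lemma trace_A_4: "trace (A ^\<^sub>m 4) = of_real (\<Sum>i<n. \<Sum>j<n. (cmod ((A * A) $$ (i, j)))\<^sup>2)"
proof -
  have AA: "A * A \<in> carrier_mat n n"
    using A_carrier by simp
  have "(A * A) $$ (i, j) * (A * A) $$ (j, i) = of_real ((cmod ((A * A) $$ (i, j)))\<^sup>2)"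
    if "i < n" "j < n" for i j
  proof -
    have "(A * A) $$ (j, i) = cnj ((A * A) $$ (i, j))"
      unfolding A_square_entry[OF that] A_square_entry[OF that(2,1)]
      by (simp add: Int_commute mult.commute)
    then show ?thesis
      by (simp only: complex_norm_square)
  qed
  then have "trace (A * A * (A * A))
    = (\<Sum>i<n. \<Sum>j<n. of_real ((cmod ((A * A) $$ (i, j)))\<^sup>2))"
    unfolding trace_mult[OF AA AA] by (intro sum.cong refl) simp
  then show ?thesis
    unfolding pow_mat_4[OF A_carrier] of_real_sum .
qed

lemma T_gain_graph_one_gain: "T_gain_graph (one_gain (base_graph \<Phi>))"
  unfolding T_gain_graph_def T_gain_graph_axioms_def one_gain_def
  using verts_numbered pair_graph_axioms by simp

section \<open>Consequences of connectedness and bipartiteness\<close>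

lemma connected_nbh_nonempty:
  assumes "Digraph_Component.connected (with_proj (base_graph \<Phi>))" "i < n" "n \<noteq> 1"
  shows "nbh i \<noteq> {}"
proof -
  have "strongly_connected (with_proj (base_graph \<Phi>))"
    using symmetric_connected_imp_strongly_connected[OF sym_arcs assms(1)] .
  moreover obtain j where "j < n" "j \<noteq> i"
    using assms by (cases "i = 0") (auto intro: that[of 0] that[of 1])
  ultimately have "reachable (with_proj (base_graph \<Phi>)) i j"
    using assms by (auto simp: strongly_connected_def verts_eq)
  \<comment> \<open>The first arc of a walk from \<open>i\<close> to a different vertex
    \<open>j\<close> supplies a neighbour of \<open>i\<close>.\<close>
  then show ?thesis
    by (cases rule: converse_reachable_cases) (use \<open>j \<noteq> i\<close> in \<open>auto simp: nbh_def\<close>)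
qed

text \<open>Changing the sign of an eigenvector on one part gives an eigenvector for the negated
  eigenvalue.\<close>

lemma bipartite_spectrum_uminus:
  assumes XY: "{..<n} = X \<union> Y" "X \<inter> Y = {}" "E \<subseteq> X \<times> Y \<union> Y \<times> X"
    and l: "l \<in> spectrum A"
  shows "- l \<in> spectrum A"
proof -
  from l obtain v where v: "v \<in> carrier_vec n" "v \<noteq> 0\<^sub>v n" "A *\<^sub>v v = l \<cdot>\<^sub>v v"
    by (auto simp: spectrum_def eigenvalue_def eigenvector_def)
  define sg where "sg i = (if i \<in> X then 1 else - 1 :: complex)" for i
  define w where "w = vec n (\<lambda>i. sg i * v $ i)"
  have "w \<noteq> 0\<^sub>v n"
  proof
    assume "w = 0\<^sub>v n"
    then have "v $ i = 0" if "i < n" for i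
      using that by (auto simp: w_def sg_def vec_eq_iff split: if_splits)
    with v show False by (auto simp: vec_eq_iff)
  qed
  moreover have "A *\<^sub>v w = (- l) \<cdot>\<^sub>v w"
  proof (rule eq_vecI)
    fix i assume "i < dim_vec ((- l) \<cdot>\<^sub>v w)"
    then have i: "i < n" by (simp add: w_def)
    have "(A *\<^sub>v w) $ i = (\<Sum>j<n. A $$ (i, j) * (sg j * v $ j))"
      using i by (simp add: scalar_prod_def w_def atLeast0LessThan)
    \<comment> \<open>Where \<open>A $$ (i, j)\<close> is nonzero, \<open>i\<close> and
      \<open>j\<close> lie in different parts, so \<open>sg j = - sg i\<close>.\<close>
    also have "\<dots> = (\<Sum>j<n. - sg i * (A $$ (i, j) * v $ j))"
    proof (rule sum.cong)
      fix j assume "j \<in> {..<n}"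
      then show "A $$ (i, j) * (sg j * v $ j) = - sg i * (A $$ (i, j) * v $ j)"
        using XY i A_zero[of i j] by (cases "j \<in> nbh i") (auto simp: nbh_def sg_def)
    qed simp
    also have "\<dots> = - sg i * (A *\<^sub>v v) $ i"
      using i v(1) by (simp add: scalar_prod_def atLeast0LessThan sum_distrib_left)
    also have "\<dots> = ((- l) \<cdot>\<^sub>v w) $ i"
      using i v(1) unfolding v(3) by (simp add: w_def)
    finally show "(A *\<^sub>v w) $ i = ((- l) \<cdot>\<^sub>v w) $ i" .
  qed (simp add: w_def)
  moreover have "w \<in> carrier_vec n"
    by (simp add: w_def)
  ultimately show ?thesis
    unfolding spectrum_def eigenvalue_def eigenvector_def by auto
qed

text \<open>Both sums count the edges: one counts the arcs leaving \<open>X\<close>, the other those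
  leaving \<open>Y\<close>, and reversing arcs exchanges the two sets.\<close>

lemma sum_card_nbh_bipartite:
  assumes XY: "{..<n} = X \<union> Y" "X \<inter> Y = {}" "E \<subseteq> X \<times> Y \<union> Y \<times> X"
  shows "(\<Sum>i\<in>X. card (nbh i)) = (\<Sum>j\<in>Y. card (nbh j))"
proof -
  have fin: "finite X" "finite Y"
    using XY(1) by (metis finite_Un finite_lessThan)+
  have iff: "i \<in> X \<and> j \<in> nbh i \<longleftrightarrow> j \<in> Y \<and> i \<in> nbh j" for i j
    using XY(2) subsetD[OF XY(3), of "(i, j)"] subsetD[OF XY(3), of "(j, i)"] nbh_sym[of j i]
    by (auto simp: nbh_def)
  have swap: "(SIGMA i:X. nbh i) = (\<lambda>(j, i). (i, j)) ` (SIGMA j:Y. nbh j)"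
    by (auto simp: image_iff) (metis iff)+
  have "(\<Sum>i\<in>X. card (nbh i)) = card (SIGMA i:X. nbh i)"
    using fin by (simp add: card_SigmaI)
  also have "\<dots> = card (SIGMA j:Y. nbh j)"
    unfolding swap by (rule card_image) (auto simp: inj_on_def)
  also have "\<dots> = (\<Sum>j\<in>Y. card (nbh j))"
    using fin by (simp add: card_SigmaI)
  finally show ?thesis .
qed

section \<open>The equality case of the entrywise bounds on \<open>A * A\<close>\<close>

lemma equality_in_trace_bound:
  assumes XY: "{..<n} = X \<union> Y" "X \<inter> Y = {}" "E \<subseteq> X \<times> Y \<union> Y \<times> X"
    and tr: "2 * trace (A ^\<^sub>m 4) = (trace (A ^\<^sub>m 2))\<^sup>2"
    and side: "{i, j} \<subseteq> X \<or> {i, j} \<subseteq> Y"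
  shows "(cmod ((A * A) $$ (i, j)))\<^sup>2 = card (nbh i) * card (nbh j)"
proof -
  define same where "same i j \<longleftrightarrow> (i \<in> X \<longleftrightarrow> j \<in> X)" for i j
  define f where "f = (\<lambda>(i, j). (cmod ((A * A) $$ (i, j)))\<^sup>2)"
  \<comment> \<open>\<open>g\<close> is the entrywise upper bound for \<open>f\<close>. Membership
    in \<open>X\<close> alone decides \<open>same\<close>, because a vertex outside \<open>X\<close>
    lies in \<open>Y\<close>.\<close>
  define g where "g = (\<lambda>(i, j). if same i j then real (card (nbh i) * card (nbh j)) else 0)"
  define m where "m = (\<Sum>i\<in>X. card (nbh i))"
  have fin: "finite X" "finite Y"
    using XY(1) by (metis finite_Un finite_lessThan)+
  have m: "(\<Sum>i\<in>X. card (nbh i)) = m" "(\<Sum>i\<in>Y. card (nbh i)) = m"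
    using sum_card_nbh_bipartite[OF XY] by (auto simp: m_def)
  have side_iff: "i \<in> X \<longleftrightarrow> k \<in> Y" if "k \<in> nbh i" for i k
    using that XY(2) subsetD[OF XY(3), of "(i, k)"] by (auto simp: nbh_def)
  have "f ij \<le> g ij" if "ij \<in> {..<n} \<times> {..<n}" for ij
  proof (cases ij)
    case (Pair i j)
    then have ij: "i < n" "j < n" using that by auto
    have "f ij \<le> (real (card (nbh i \<inter> nbh j)))\<^sup>2"
      unfolding f_def Pair using cmod_A_square_le[OF ij] by (simp add: power_mono)
    also have "\<dots> \<le> g ij"
    proof (cases "same i j")
      case True
      have "card (nbh i \<inter> nbh j) * card (nbh i \<inter> nbh j) \<le> card (nbh i) * card (nbh j)"
        by (intro mult_mono card_mono) auto
      then show ?thesis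
        using True by (simp add: g_def Pair power2_eq_square flip: of_nat_mult)
    next
      case False
      \<comment> \<open>Neighbours of vertices from different parts again lie in different
        parts.\<close>
      then have "nbh i \<inter> nbh j = {}"
        using side_iff by (auto simp: same_def)
      then show ?thesis using False by (simp add: g_def Pair)
    qed
    finally show ?thesis .
  qed
  moreover have "sum f ({..<n} \<times> {..<n}) = sum g ({..<n} \<times> {..<n})"
  proof -
    have split: "(\<Sum>i<n. h i) = (\<Sum>i\<in>X. h i) + (\<Sum>i\<in>Y. h i)" for h :: "nat \<Rightarrow> real"
      unfolding XY(1) using fin XY(2) by (rule sum.union_disjoint)
    let ?d = "\<lambda>i. real (card (nbh i))"
    have dm: "(\<Sum>i\<in>X. ?d i) = m" "(\<Sum>i\<in>Y. ?d i) = m"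
      using m by (simp_all flip: of_nat_sum)
    have sum_f: "sum f ({..<n} \<times> {..<n}) = (\<Sum>i<n. \<Sum>j<n. (cmod ((A * A) $$ (i, j)))\<^sup>2)"
      unfolding f_def by (rule sum.cartesian_product[symmetric])
    \<comment> \<open>The trace of the fourth power is the sum of \<open>f\<close>, and that of the
      square is the degree sum \<open>2 * m\<close>; the hypothesis thus reads
      \<open>2 * sum f = (2 * m)\<^sup>2\<close>.\<close>
    have "of_real (2 * sum f ({..<n} \<times> {..<n})) = (of_real ((\<Sum>i<n. ?d i)\<^sup>2) :: complex)"
      using tr unfolding trace_A_2 trace_A_4 sum_f
      by (simp del: index_mult_mat(1))
    then have "2 * sum f ({..<n} \<times> {..<n}) = (\<Sum>i<n. ?d i)\<^sup>2"
      using of_real_eq_iff by blast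
    then have "sum f ({..<n} \<times> {..<n}) = 2 * (real m)\<^sup>2"
      unfolding split dm by (simp add: power2_eq_square)
    \<comment> \<open>Row \<open>i\<close> of \<open>g\<close> runs over the part of
      \<open>i\<close> only, whose degree sum is \<open>m\<close>. Summing these rows over both
      parts gives \<open>2 * m\<^sup>2\<close> once more.\<close>
    moreover have "(\<Sum>j<n. g (i, j)) = ?d i * m" if "i < n" for i
    proof -
      have "(\<Sum>j<n. g (i, j)) = (\<Sum>j\<in>(if i \<in> X then X else Y). ?d i * ?d j)"
        unfolding split using XY(2)
        by (auto simp: g_def same_def intro!: sum.cong sum.neutral)
      then show ?thesis
        by (auto simp flip: sum_distrib_left simp: dm)
    qed
    then have "sum g ({..<n} \<times> {..<n}) = (\<Sum>i<n. ?d i * m)"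
      using sum.cartesian_product[of "\<lambda>i j. g (i, j)" "{..<n}" "{..<n}"] by simp
    then have "sum g ({..<n} \<times> {..<n}) = 2 * (real m)\<^sup>2"
      unfolding split by (simp flip: sum_distrib_right add: dm power2_eq_square)
    ultimately show ?thesis by simp
  qed
  moreover have "(i, j) \<in> {..<n} \<times> {..<n}"
    using side XY(1) by auto
  \<comment> \<open>A termwise inequality between finite families with equal sums is an equality in
    every term.\<close>
  ultimately have "f (i, j) = g (i, j)"
    by (intro sum_mono_inv[of f "{..<n} \<times> {..<n}" g]) auto
  moreover have "same i j"
    using side XY(2) by (auto simp: same_def)
  ultimately show ?thesis
    by (simp add: f_def g_def del: index_mult_mat(1))
qed

text \<open>The modulus of the entry is at most the number of common neighbours, whose square is at
  most the product of the degrees. Equality throughout makes the neighbourhoods coincide and aligns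
  the unit summands of the entry, so rows \<open>i\<close> and \<open>j\<close> are
  proportional.\<close>

lemma equality_same_side:
  assumes ij: "i < n" "j < n" "nbh i \<noteq> {}" "nbh j \<noteq> {}"
    and eq: "(cmod ((A * A) $$ (i, j)))\<^sup>2 = card (nbh i) * card (nbh j)"
  shows "nbh i = nbh j"
    and "k \<in> nbh i \<Longrightarrow> l \<in> nbh i \<Longrightarrow>
      A $$ (i, k) * cnj (A $$ (j, k)) = A $$ (i, l) * cnj (A $$ (j, l))"
proof -
  define c where "c = card (nbh i \<inter> nbh j)"
  have le: "c \<le> card (nbh i)" "c \<le> card (nbh j)"
    by (auto simp: c_def intro: card_mono)
  have pos: "card (nbh i) > 0" "card (nbh j) > 0"
    using ij by (auto simp: card_gt_0_iff)
  have "(cmod ((A * A) $$ (i, j)))\<^sup>2 \<le> (real c)\<^sup>2"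
    using cmod_A_square_le[OF ij(1,2)] by (simp add: c_def power_mono del: index_mult_mat(1))
  then have cc: "card (nbh i) * card (nbh j) \<le> c * c"
    unfolding eq unfolding power2_eq_square of_nat_mult[symmetric] by (simp only: of_nat_le_iff)
  have ci: "c = card (nbh i)" and cj: "c = card (nbh j)"
  proof -
    \<comment> \<open>Cancelling the positive degree of \<open>j\<close>, respectively of
      \<open>i\<close>, bounds the other degree by \<open>c\<close>.\<close>
    have "card (nbh i) * card (nbh j) \<le> c * card (nbh j)" "card (nbh i) * card (nbh j) \<le> card (nbh i) * c"
      using cc le by (meson le_trans mult_le_mono order_refl)+
    then show "c = card (nbh i)" "c = card (nbh j)"
      using le pos by auto
  qed
  have "nbh i \<inter> nbh j = nbh i" "nbh i \<inter> nbh j = nbh j"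
    using ci cj unfolding c_def by (intro card_subset_eq; simp)+
  then show nbh: "nbh i = nbh j" by simp
  assume kl: "k \<in> nbh i" "l \<in> nbh i"
  have "(cmod ((A * A) $$ (i, j)))\<^sup>2 = (real c)\<^sup>2"
    unfolding eq ci[symmetric] cj[symmetric] by (simp add: power2_eq_square)
  then have "cmod ((A * A) $$ (i, j)) = card (nbh i)"
    unfolding ci[symmetric] by (simp del: index_mult_mat(1))
  then have "cmod (\<Sum>k\<in>nbh i. A $$ (i, k) * cnj (A $$ (j, k))) = card (nbh i)"
    unfolding A_square_entry[OF ij(1,2)] nbh[symmetric] by simp
  moreover have "cmod (A $$ (i, k) * cnj (A $$ (j, k))) = 1" if "k \<in> nbh i" for k
    using that nbh by (simp add: norm_mult A_unit)
  ultimately show "A $$ (i, k) * cnj (A $$ (j, k)) = A $$ (i, l) * cnj (A $$ (j, l))"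
    using kl by (intro unit_sum_eq_card_imp_eq[of "nbh i"]) auto
qed

section \<open>Switching all gains to 1\<close>

lemma switching_equivalentI:
  assumes u: "\<And>i. i < n \<Longrightarrow> cmod (u i) = 1"
    and 1: "\<And>i j. (i, j) \<in> E \<Longrightarrow> u i * A $$ (i, j) * cnj (u j) = 1"
  shows "switching_equivalent \<Phi> (one_gain (base_graph \<Phi>))"
proof -
  let ?U = "mat_diag n u"
  have one: "mat_diag n (\<lambda>i. u i * cnj (u i)) = 1\<^sub>m n" "mat_diag n (\<lambda>i. cnj (u i) * u i) = 1\<^sub>m n"
    by (auto simp: mat_diag_def one_mat_def complex_norm_square[symmetric] mult.commute u
        intro!: cong_mat)
  have "unitary_mat n ?U"
    unfolding unitary_mat_def mat_adjoint_mat_diag mat_diag_diag one by simp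
  moreover have "diagonal_mat ?U"
    by (auto simp: diagonal_mat_def mat_diag_def)
  moreover have "adj_mat (one_gain (base_graph \<Phi>)) = ?U * A * mat_adjoint ?U"
  proof -
    have "?U * A * mat_adjoint ?U = mat n n (\<lambda>(i, j). u i * A $$ (i, j) * cnj (u j))"
      unfolding mat_adjoint_mat_diag mat_diag_mult_left[OF A_carrier]
      by (subst mat_diag_mult_right[of _ n]) (auto intro!: cong_mat)
    also have "\<dots> = mat n n (\<lambda>(i, j). if (i, j) \<in> E then 1 else 0)"
      using 1 A_zero by (auto simp: nbh_def intro!: eq_matI)
    also have "\<dots> = adj_mat (one_gain (base_graph \<Phi>))"
      by (auto simp: adj_mat_def num_verts_def one_gain_def intro!: cong_mat)
    finally show ?thesis ..
  qed
  ultimately show ?thesis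
    unfolding switching_equivalent_def by blast
qed

lemma imp_switching_equivalent_Kpq:
  assumes XY: "{..<n} = X \<union> Y" "X \<inter> Y = {}" "E \<subseteq> X \<times> Y \<union> Y \<times> X"
    and tr: "2 * trace (A ^\<^sub>m 4) = (trace (A ^\<^sub>m 2))\<^sup>2"
    and nbh: "\<And>i. i < n \<Longrightarrow> nbh i \<noteq> {}" and "n > 0"
  shows "switching_equivalent_Kpq \<Phi> (card X) (card Y)"
proof -
  note eq = equality_same_side[OF _ _ nbh nbh equality_in_trace_bound[OF XY tr]]
  have nX: "i < n" if "i \<in> X" for i
    using that XY(1) by auto
  have nY: "i < n" if "i \<in> Y" for i
    using that XY(1) by auto
  have arcX: "j \<in> Y" if "j \<in> nbh i" "i \<in> X" for i j
    using that XY by (auto simp: nbh_def)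
  have arcY: "j \<in> X" if "j \<in> nbh i" "i \<in> Y" for i j
    using that XY by (auto simp: nbh_def)
  \<comment> \<open>Some \<open>x'\<close> in \<open>X\<close> is adjacent to \<open>y\<close>; as
    \<open>x\<close> and \<open>x'\<close> lie in the same part, they share their neighbours, so
    \<open>y\<close> is also adjacent to \<open>x\<close>.\<close>
  have complete: "y \<in> nbh x" if xy: "x \<in> X" "y \<in> Y" for x y
  proof -
    obtain x' where "x' \<in> nbh y" using nbh[OF nY[OF xy(2)]] by blast
    then show ?thesis
      using eq(1)[of x' x] arcY[of x' y] xy nX nbh_sym by auto
  qed
  have E: "E = X \<times> Y \<union> Y \<times> X"
    using XY(3) complete arcD(3) by (auto simp: nbh_def)
  \<comment> \<open>Vertex 0 has a neighbour, which lies in the opposite part, so neither part is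
    empty.\<close>
  obtain x0 y0 where 0: "x0 \<in> X" "y0 \<in> Y"
    using XY(1) \<open>n > 0\<close> nbh[of 0] arcX arcY by blast
  \<comment> \<open>This choice, with \<open>u y0 = 1\<close>, turns the gains of all arcs into
    \<open>y0\<close> and of all arcs out of \<open>x0\<close> into 1; proportionality of the rows
    then settles the remaining arcs.\<close>
  define u where
    "u i = (if i \<in> X then cnj (A $$ (i, y0)) else A $$ (x0, i) * cnj (A $$ (x0, y0)))" for i
  have unit: "cmod (A $$ (x, y)) = 1" if "x \<in> X" "y \<in> Y" for x y
    using A_unit complete that by blast
  have u1: "cmod (u i) = 1" if "i < n" for i
  proof (cases "i \<in> X")
    case True
    then show ?thesis using 0 by (simp add: u_def unit)
  next
    case False
    then have "i \<in> Y" using that XY(1) by auto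
    with False 0 show ?thesis by (simp add: u_def unit norm_mult)
  qed
  have XY1: "u x * A $$ (x, y) * cnj (u y) = 1" if "x \<in> X" "y \<in> Y" for x y
  proof -
    have "u x * A $$ (x, y) * cnj (u y)
      = cnj (A $$ (x, y0)) * (A $$ (x, y) * cnj (A $$ (x0, y))) * A $$ (x0, y0)"
      using that XY(2) by (auto simp: u_def)
    \<comment> \<open>Proportionality of rows \<open>x\<close> and \<open>x0\<close> allows column
      \<open>y\<close> to be replaced by column \<open>y0\<close>.\<close>
    also have "A $$ (x, y) * cnj (A $$ (x0, y)) = A $$ (x, y0) * cnj (A $$ (x0, y0))"
      using that 0 complete nX by (intro eq(2)) auto
    also have "cnj (A $$ (x, y0)) * \<dots> * A $$ (x0, y0)
      = (A $$ (x, y0) * cnj (A $$ (x, y0))) * (A $$ (x0, y0) * cnj (A $$ (x0, y0)))"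
      by (simp add: mult_ac)
    also have "\<dots> = 1"
      unfolding complex_norm_square[symmetric] using unit that 0 by simp
    finally show ?thesis .
  qed
  have "switching_equivalent \<Phi> (one_gain (base_graph \<Phi>))"
  proof (rule switching_equivalentI[OF u1])
    fix i j assume ij: "(i, j) \<in> E"
    show "u i * A $$ (i, j) * cnj (u j) = 1"
    proof (cases "i \<in> X")
      case True
      then show ?thesis using XY1 arcX ij by (simp add: nbh_def)
    next
      case False
      then have "i \<in> Y" "j \<in> X" using ij XY by auto
      then have "u j * A $$ (j, i) * cnj (u i) = 1" using XY1 by blast
      \<comment> \<open>Arcs from \<open>Y\<close> to \<open>X\<close> follow from their reversals
        by conjugation, since \<open>A\<close> is Hermitian.\<close>
      then have "cnj (u j * A $$ (j, i) * cnj (u i)) = 1" by simp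
      then show ?thesis
        using A_cnj[of j i] arcD[OF ij] by (simp add: mult_ac)
    qed
  qed
  moreover have "complete_bipartite_digraph (card X) (card Y) (with_proj (base_graph \<Phi>))"
    unfolding complete_bipartite_digraph_pair_def verts_eq using XY(1,2) E by blast
  ultimately show ?thesis
    unfolding switching_equivalent_Kpq_def using T_gain_graph_one_gain by blast
qed

text \<open>A single vertex has no neighbour, so the argument through nonempty neighbourhoods does
  not cover it; here the second part is empty.\<close>

lemma single_vertex_switching_equivalent_Kpq:
  assumes "n = 1"
  shows "switching_equivalent_Kpq \<Phi> 1 0"
proof -
  have E: "E = {}"
    using arcD assms by fastforce
  have "switching_equivalent \<Phi> (one_gain (base_graph \<Phi>))"
    by (rule switching_equivalentI[of "\<lambda>_. 1"]) (auto simp: E)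
  moreover have "complete_bipartite_digraph 1 0 (with_proj (base_graph \<Phi>))"
    unfolding complete_bipartite_digraph_pair_def
    using E verts_eq assms by (intro conjI exI[of _ "{0}"] exI[of _ "{}"]) auto
  ultimately show ?thesis
    unfolding switching_equivalent_Kpq_def using T_gain_graph_one_gain by blast
qed

end

section \<open>The converse: complete bipartite graphs and invariance under switching\<close>

lemma one_gain_Kpq_energy:
  assumes "complete_bipartite_digraph p q (with_proj H)" "T_gain_graph (one_gain H)"
    and "num_verts (one_gain H) > 0"
  shows "energy (one_gain H) = 2 * rho (one_gain H)"
proof -
  interpret T_gain_graph "one_gain H" by fact
  obtain V W where VW: "pverts H = V \<union> W" "V \<inter> W = {}" "card V = p" "card W = q"
      "parcs H = V \<times> W \<union> W \<times> V"
    using assms(1) unfolding complete_bipartite_digraph_pair_def by blast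
  have base: "base_graph (one_gain H) = H" by (simp add: one_gain_def)
  have gain_1: "gain (one_gain H) e = 1" for e
    by (simp add: one_gain_def)
  have n: "{..<n} = V \<union> W"
    using verts_eq VW(1) base by simp
  have fin: "finite V" "finite W"
    using n by (metis finite_Un finite_lessThan)+
  have nbh: "nbh i = W" if "i \<in> V" for i
    using that VW by (auto simp: nbh_def base)
  have nbh': "nbh i = V" if "i \<in> W" for i
    using that VW by (auto simp: nbh_def base)
  have "(\<Sum>i<n. card (nbh i)) = (\<Sum>i\<in>V. card (nbh i)) + (\<Sum>i\<in>W. card (nbh i))"
    unfolding n using fin VW(2) by (rule sum.union_disjoint)
  also have "\<dots> = 2 * (p * q)"
    using VW by (simp add: nbh nbh' mult.commute)
  finally have tr: "trace (A ^\<^sub>m 2) = of_real (2 * real (p * q))"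
    unfolding trace_A_2 by simp
  have "l = 0 \<or> l\<^sup>2 = of_real (real (p * q))" if "l \<in> spectrum A" for l
  proof (rule disjCI)
    assume "l\<^sup>2 \<noteq> of_real (real (p * q))"
    from that obtain v where v: "v \<in> carrier_vec n" "v \<noteq> 0\<^sub>v n" "A *\<^sub>v v = l \<cdot>\<^sub>v v"
      by (auto simp: spectrum_def eigenvalue_def eigenvector_def)
    \<comment> \<open>The eigenvalue equation makes \<open>l * v $ i\<close> equal to the sum of
      \<open>v\<close> over the opposite part, so the two part sums \<open>a\<close> and
      \<open>b\<close> determine \<open>v\<close> up to the factor \<open>l\<close>.\<close>
    define a where "a = (\<Sum>i\<in>V. v $ i)"
    define b where "b = (\<Sum>i\<in>W. v $ i)"
    have lv: "l * v $ i = (\<Sum>j\<in>nbh i. v $ j)" if "i < n" for i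
    proof -
      have "l * v $ i = (A *\<^sub>v v) $ i"
        using that v(1) unfolding v(3) by simp
      also have "\<dots> = (\<Sum>j<n. A $$ (i, j) * v $ j)"
        using that v(1) by (simp add: scalar_prod_def atLeast0LessThan)
      also have "\<dots> = (\<Sum>j\<in>nbh i. A $$ (i, j) * v $ j)"
        using nbh_subset that A_zero[of i] by (intro sum.mono_neutral_right) auto
      also have "\<dots> = (\<Sum>j\<in>nbh i. v $ j)"
        using nbh_subset[of i] that
        by (intro sum.cong) (auto simp: A_entry gain_1)
      finally show ?thesis .
    qed
    have V: "l * v $ i = b" if "i \<in> V" for i
      using lv[of i] nbh[OF that] n that by (auto simp: b_def)
    have W: "l * v $ i = a" if "i \<in> W" for i
      using lv[of i] nbh'[OF that] n that by (auto simp: a_def)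
    have "l * a = of_nat p * b" "l * b = of_nat q * a"
      using VW V W by (simp_all add: a_def b_def sum_distrib_left)
    \<comment> \<open>Substituting each relation into the other shows that \<open>a\<close> and
      \<open>b\<close> vanish unless \<open>l\<^sup>2\<close> is \<open>p * q\<close>; then
      \<open>l * v = 0\<close> and hence \<open>l = 0\<close>.\<close>
    then have "l\<^sup>2 * a = of_real (real (p * q)) * a" "l\<^sup>2 * b = of_real (real (p * q)) * b"
      unfolding power2_eq_square by (simp_all add: mult.assoc)
    then have "a = 0" "b = 0"
      using \<open>l\<^sup>2 \<noteq> _\<close> by auto
    then have "l * v $ i = 0" if "i < n" for i
      using that n V W by auto
    then show "l = 0"
      using v(1,2) by (auto simp: vec_eq_iff)
  qed
  from two_spectral_radius_eqI[OF A_carrier assms(3) this tr] show ?thesis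
    by (simp add: energy_def rho_def)
qed

text \<open>Conjugation by a unitary matrix is a similarity, so it keeps the characteristic
  polynomial, from which both energy and spectral radius are computed.\<close>

lemma switching_equivalent_energy_rho:
  assumes "switching_equivalent \<Phi> \<Phi>'"
  shows "num_verts \<Phi>' = num_verts \<Phi>" "energy \<Phi>' = energy \<Phi>" "rho \<Phi>' = rho \<Phi>"
proof -
  obtain U where U: "unitary_mat (num_verts \<Phi>) U" "adj_mat \<Phi>' = U * adj_mat \<Phi> * mat_adjoint U"
    using assms unfolding switching_equivalent_def by blast
  let ?n = "num_verts \<Phi>"
  have car: "U \<in> carrier_mat ?n ?n" "adj_mat \<Phi> \<in> carrier_mat ?n ?n"
    using U by (auto simp: unitary_mat_def adj_mat_def)
  then have adj: "mat_adjoint U \<in> carrier_mat ?n ?n"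
    by (auto simp: mat_adjoint_def)
  have car': "adj_mat \<Phi>' \<in> carrier_mat ?n ?n"
    unfolding U(2) using car adj by auto
  then show "num_verts \<Phi>' = ?n"
    by (auto simp: adj_mat_def)
  have "similar_mat (adj_mat \<Phi>') (adj_mat \<Phi>)"
    by (rule similar_matI[of _ _ U "mat_adjoint U" ?n])
      (use U car adj car' in \<open>auto simp: unitary_mat_def\<close>)
  from char_poly_similar[OF this] have cp: "char_poly (adj_mat \<Phi>') = char_poly (adj_mat \<Phi>)" .
  then show "energy \<Phi>' = energy \<Phi>"
    by (simp add: energy_def)
  show "rho \<Phi>' = rho \<Phi>"
    by (simp add: rho_def spectral_radius_def spectrum_root_char_poly[OF car(2)]
        spectrum_root_char_poly[OF car'] cp)
qed

theorem theorem4p4: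
  fixes \<Phi> :: gain_graph
  assumes "T_gain_graph \<Phi>"
    and "Digraph_Component.connected (with_proj (base_graph \<Phi>))"
  shows "energy \<Phi> \<ge> 2 * rho \<Phi> \<and>
    (bipartite (base_graph \<Phi>) \<longrightarrow>
       (energy \<Phi> = 2 * rho \<Phi> \<longleftrightarrow> (\<exists>p q. switching_equivalent_Kpq \<Phi> p q)))"
proof -
  interpret T_gain_graph \<Phi> by fact
  \<comment> \<open>Connectedness in the sense used here includes that the vertex set is
    nonempty.\<close>
  have "n > 0"
    using assms(2) verts_eq
    by (auto simp: Digraph_Component.connected_def strongly_connected_def)
  show ?thesis
  proof (intro conjI impI iffI)
    show "2 * rho \<Phi> \<le> energy \<Phi>"
      using two_spectral_radius_le[OF A_carrier \<open>n > 0\<close> trace_A] by (simp add: energy_def rho_def)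
  next
    assume "bipartite (base_graph \<Phi>)" and eq: "energy \<Phi> = 2 * rho \<Phi>"
    then obtain X Y where XY: "{..<n} = X \<union> Y" "X \<inter> Y = {}" "E \<subseteq> X \<times> Y \<union> Y \<times> X"
      unfolding bipartite_def verts_eq by blast
    show "\<exists>p q. switching_equivalent_Kpq \<Phi> p q"
    proof (cases "n = 1")
      case True
      then show ?thesis using single_vertex_switching_equivalent_Kpq by blast
    next
      case False
      have "2 * trace (A ^\<^sub>m 4) = (trace (A ^\<^sub>m 2))\<^sup>2"
        using eq bipartite_spectrum_uminus[OF XY]
        by (intro two_spectral_radius_eq_imp_trace[OF A_carrier \<open>n > 0\<close>])
          (simp_all add: energy_def rho_def)
      from imp_switching_equivalent_Kpq[OF XY this connected_nbh_nonempty[OF assms(2) _ False] \<open>n > 0\<close>]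
      show ?thesis by blast
    qed
  next
    assume "\<exists>p q. switching_equivalent_Kpq \<Phi> p q"
    then obtain p q H where "complete_bipartite_digraph p q (with_proj H)"
        "T_gain_graph (one_gain H)" and sw: "switching_equivalent \<Phi> (one_gain H)"
      unfolding switching_equivalent_Kpq_def by blast
    then show "energy \<Phi> = 2 * rho \<Phi>"
      using one_gain_Kpq_energy \<open>n > 0\<close> switching_equivalent_energy_rho[OF sw] by simp
  qed
qed

end
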